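(* Let $n\in\mathbb{N}$, $k\in\{0,1,\ldots,n-1\}$, $1\le p\le\infty$, $a\in(0,1)$, and let $\nu_0,\nu_1,\ldots,\nu_{n-1}$ be arbitrary real coefficients (possibly depending on $a$). Let $Q_{n,k}(\cdot,a)$ be a function on $[0,1]$ whose $n$-th derivative in $x$ is $$ Q^{(n)}_{n,k}(x,a)= \begin{cases} \displaystyle\sum_{l=0,\,l\ne k}^{n-1}\frac{(-1)^{n-l-1}(x-a)^{n-1-l}\nu_l}{(n-1-l)!}+\frac{(-1)^{n-1-k}(x-a)^{n-1-k}(\nu_k+1)}{(n-1-k)!}, & x\in[0,a),\\[2mm] \displaystyle\sum_{l=0}^{n-1}\frac{(-1)^{n-l-1}(x-a)^{n-1-l}\nu_l}{(n-1-l)!}, & x\in(a,1]. \end{cases} $$ Then for every function $y\in\mathring{W}^n_p[0,1]$, $$ y^{(k)}(a)=\int_0^1 y^{(n)}(x)\,Q^{(n)}_{n,k}(x,a)\,dx . $$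
   Context: $\mathring{W}^n_p[0,1]$ is the Sobolev space of real-valued functions $y$ on $[0,1]$ whose derivatives up to order $n-1$ are absolutely continuous, with $y^{(n)}\in L_p[0,1]$, and with $y^{(j)}(0)=y^{(j)}(1)=0$ for $j=0,1,\ldots,n-1$. The convention $(x-a)^0=1$ is used. *)

theory Defs
  imports "HOL-Analysis.Analysis"
begin

text \<open>
  Derivatives are taken within the domain \<open>S\<close>: they are one-sided at endpoints of intervals
  and, at points of \<open>S\<close>, depend only on the values of the function on \<open>S\<close>. As usual for total
  functions, the value carries no information where the derivative fails to exist.
\<close>
primrec deriv_on :: "real set \<Rightarrow> nat \<Rightarrow> (real \<Rightarrow> real) \<Rightarrow> real \<Rightarrow> real" where
  "deriv_on S 0 f = f"
| "deriv_on S (Suc j) f = (\<lambda>x. vector_derivative (deriv_on S j f) (at x within S))"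

definition times_differentiable_on :: "nat \<Rightarrow> (real \<Rightarrow> real) \<Rightarrow> real set \<Rightarrow> bool" where
  "times_differentiable_on m f S \<longleftrightarrow> (\<forall>j<m. deriv_on S j f differentiable_on S)"

text \<open>The library's \<open>absolutely_continuous\<close> is a relation between measures, not this notion.\<close>
definition absolutely_continuous_fun_on :: "(real \<Rightarrow> real) \<Rightarrow> real set \<Rightarrow> bool" where
  "absolutely_continuous_fun_on f S \<longleftrightarrow>
    (\<forall>\<epsilon>>0. \<exists>\<delta>>0. \<forall>(m::nat) u v.
       (\<forall>i<m. u i \<le> v i \<and> {u i..v i} \<subseteq> S) \<and>
       pairwise (\<lambda>i j. {u i<..<v i} \<inter> {u j<..<v j} = {}) {..<m} \<and>
       (\<Sum>i<m. v i - u i) < \<delta> \<longrightarrow>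
       (\<Sum>i<m. \<bar>f (v i) - f (u i)\<bar>) < \<epsilon>)"

definition Lp_functions :: "ennreal \<Rightarrow> 'a measure \<Rightarrow> ('a \<Rightarrow> real) set" where
  "Lp_functions p M =
    {f \<in> borel_measurable M.
       if p = \<infinity> then \<exists>C. AE x in M. \<bar>f x\<bar> \<le> C
       else integrable M (\<lambda>x. \<bar>f x\<bar> powr enn2real p)}"

text \<open>
  Meant for \<open>n \<ge> 1\<close>. The derivative of order \<open>n\<close> need only exist almost everywhere; the clause
  saying so is part of what membership of that derivative in \<open>L\<^sub>p\<close> means (it also follows from
  absolute continuity of the derivative of order \<open>n - 1\<close>).
\<close>
definition sobolev_zero :: "nat \<Rightarrow> ennreal \<Rightarrow> (real \<Rightarrow> real) set" where
  "sobolev_zero n p =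
    {y. times_differentiable_on (n - 1) y {0..1} \<and>
        (\<forall>j<n. absolutely_continuous_fun_on (deriv_on {0..1} j y) {0..1}) \<and>
        (AE x in lebesgue_on {0..1}.
           deriv_on {0..1} (n - 1) y differentiable (at x within {0..1})) \<and>
        deriv_on {0..1} n y \<in> Lp_functions p (lebesgue_on {0..1}) \<and>
        (\<forall>j<n. deriv_on {0..1} j y 0 = 0 \<and> deriv_on {0..1} j y 1 = 0)}"

end

theory Submission
  imports Defs
begin

text \<open>
  The formula is Taylor's formula with integral remainder, read from both ends of the interval.
  For absolutely continuous \<open>y, \<dots>, y\<^sup>(\<^sup>n\<^sup>-\<^sup>1\<^sup>)\<close> and \<open>m = n - 1 - l\<close>, the function
  \<open>G(x) = \<Sum>i\<le>m. y\<^sup>(\<^sup>l\<^sup>+\<^sup>i\<^sup>)(x) (a - x)\<^sup>i / i!\<close> has a derivative that telescopes to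
  \<open>y\<^sup>(\<^sup>n\<^sup>)(x) (a - x)\<^sup>m / m!\<close> almost everywhere. Since \<open>G(0) = G(1) = 0\<close> and
  \<open>G(a) = y\<^sup>(\<^sup>l\<^sup>)(a)\<close>, integrating \<open>y\<^sup>(\<^sup>n\<^sup>)\<close> against \<open>(a - x)\<^sup>m / m!\<close> gives \<open>y\<^sup>(\<^sup>l\<^sup>)(a)\<close> over
  \<open>[0,a]\<close> and \<open>-y\<^sup>(\<^sup>l\<^sup>)(a)\<close> over \<open>[a,1]\<close> (\<open>sobolev_zero_kernel_integrals\<close>). The kernel of the theorem
  is a combination of these monomials, with coefficient \<open>\<nu>\<^sub>l\<close> on the right of \<open>a\<close> and the same
  coefficient, increased by one for \<open>l = k\<close>, on the left; so all contributions cancel except one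
  copy of \<open>y\<^sup>(\<^sup>k\<^sup>)(a)\<close>.

  The analytic content is the fundamental theorem of calculus for an absolutely continuous
  function that is differentiable almost everywhere. It is proved for the Henstock-Kurzweil
  integral, where a gauge can treat good and exceptional tags separately and where the
  integrability of the derivative comes for free. The Lebesgue integral agrees with it because
  \<open>y\<^sup>(\<^sup>n\<^sup>)\<close> is integrable (\<open>L\<^sub>p \<subseteq> L\<^sub>1\<close> on a finite measure space) and the kernel is bounded.
\<close>

section \<open>Absolutely continuous functions\<close>

text \<open>
  The definition indexes the intervals by an initial segment of the naturals; the intervals of a
  tagged division are indexed by the division itself, which calls for arbitrary finite index sets.
\<close>

lemma absolutely_continuous_fun_on_finite_family:
  assumes "absolutely_continuous_fun_on f S" and "\<epsilon> > 0"
  obtains \<delta> where "\<delta> > 0"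
    and "\<And>(I :: 'i set) u v. finite I \<Longrightarrow> (\<And>i. i \<in> I \<Longrightarrow> u i \<le> v i \<and> {u i..v i} \<subseteq> S)
      \<Longrightarrow> pairwise (\<lambda>i j. {u i<..<v i} \<inter> {u j<..<v j} = {}) I
      \<Longrightarrow> (\<Sum>i\<in>I. v i - u i) < \<delta> \<Longrightarrow> (\<Sum>i\<in>I. \<bar>f (v i) - f (u i)\<bar>) < \<epsilon>"
proof -
  obtain \<delta> where "\<delta> > 0" and \<delta>: "\<forall>(m::nat) u v.
       (\<forall>i<m. u i \<le> v i \<and> {u i..v i} \<subseteq> S) \<and>
       pairwise (\<lambda>i j. {u i<..<v i} \<inter> {u j<..<v j} = {}) {..<m} \<and>
       (\<Sum>i<m. v i - u i) < \<delta> \<longrightarrow> (\<Sum>i<m. \<bar>f (v i) - f (u i)\<bar>) < \<epsilon>"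
    using assms unfolding absolutely_continuous_fun_on_def by blast
  have "(\<Sum>i\<in>I. \<bar>f (v i) - f (u i)\<bar>) < \<epsilon>"
    if I: "finite I" and uv: "\<And>i. i \<in> I \<Longrightarrow> u i \<le> v i \<and> {u i..v i} \<subseteq> S"
      and disj: "pairwise (\<lambda>i j. {u i<..<v i} \<inter> {u j<..<v j} = {}) I"
      and len: "(\<Sum>i\<in>I. v i - u i) < \<delta>" for I :: "'i set" and u v
  proof -
    obtain h where h: "bij_betw h {..<card I} I"
      using ex_bij_betw_nat_finite[OF I] by (auto simp: atLeast0LessThan)
    have reindex: "(\<Sum>i\<in>I. g i) = (\<Sum>i<card I. g (h i))" for g :: "'i \<Rightarrow> real"
      using sum.reindex_bij_betw[OF h, of g] by simp
    have "pairwise (\<lambda>i j. {u (h i)<..<v (h i)} \<inter> {u (h j)<..<v (h j)} = {}) {..<card I}"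
      using disj bij_betwE[OF h] bij_betw_imp_inj_on[OF h]
      by (auto simp: pairwise_def inj_on_eq_iff)
    moreover have "\<forall>i<card I. u (h i) \<le> v (h i) \<and> {u (h i)..v (h i)} \<subseteq> S"
      using uv bij_betwE[OF h] by (metis lessThan_iff)
    ultimately show ?thesis
      using \<delta>[rule_format, of "card I" "u \<circ> h" "v \<circ> h"] len by (simp add: reindex)
  qed
  with \<open>\<delta> > 0\<close> that show thesis by blast
qed

lemma absolutely_continuous_fun_on_subset:
  "absolutely_continuous_fun_on f S \<Longrightarrow> T \<subseteq> S \<Longrightarrow> absolutely_continuous_fun_on f T"
  unfolding absolutely_continuous_fun_on_def by (meson order_trans)

lemma absolutely_continuous_fun_on_imp_continuous_on:
  assumes f: "absolutely_continuous_fun_on f {\<alpha>..\<beta>}"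
  shows "continuous_on {\<alpha>..\<beta>} f"
  unfolding continuous_on_iff
proof (intro ballI allI impI)
  fix x \<epsilon> :: real assume x: "x \<in> {\<alpha>..\<beta>}" and "\<epsilon> > 0"
  then obtain \<delta> where "\<delta> > 0" and \<delta>: "\<And>(I :: nat set) u v. finite I
      \<Longrightarrow> (\<And>i. i \<in> I \<Longrightarrow> u i \<le> v i \<and> {u i..v i} \<subseteq> {\<alpha>..\<beta>})
      \<Longrightarrow> pairwise (\<lambda>i j. {u i<..<v i} \<inter> {u j<..<v j} = {}) I
      \<Longrightarrow> (\<Sum>i\<in>I. v i - u i) < \<delta> \<Longrightarrow> (\<Sum>i\<in>I. \<bar>f (v i) - f (u i)\<bar>) < \<epsilon>"
    using absolutely_continuous_fun_on_finite_family[OF f] by blast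
  have "dist (f z) (f x) < \<epsilon>" if "z \<in> {\<alpha>..\<beta>}" "dist z x < \<delta>" for z
    using \<delta>[of "{0}" "\<lambda>_. min x z" "\<lambda>_. max x z"] x that
    by (auto simp: dist_real_def min_def max_def abs_if split: if_splits)
  with \<open>\<delta> > 0\<close> show "\<exists>d>0. \<forall>z\<in>{\<alpha>..\<beta>}. dist z x < d \<longrightarrow> dist (f z) (f x) < \<epsilon>"
    by blast
qed

text \<open>Sums, products and affine functions share one reason: a variation bounded by a linear
  combination of variations of absolutely continuous functions is small when those are.\<close>

lemma absolutely_continuous_fun_on_dominated:
  assumes f: "absolutely_continuous_fun_on f S" and g: "absolutely_continuous_fun_on g S"
    and h: "\<And>u v. u \<in> S \<Longrightarrow> v \<in> S \<Longrightarrow> \<bar>h v - h u\<bar> \<le> C * \<bar>f v - f u\<bar> + C * \<bar>g v - g u\<bar>"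
    and "C > 0"
  shows "absolutely_continuous_fun_on h S"
  unfolding absolutely_continuous_fun_on_def
proof (intro allI impI)
  fix \<epsilon> :: real assume "\<epsilon> > 0"
  then have pos: "\<epsilon> / (2 * C) > 0" using \<open>C > 0\<close> by simp
  let ?small = "\<lambda>\<delta> f. \<forall>(m::nat) u v.
       (\<forall>i<m. u i \<le> v i \<and> {u i..v i} \<subseteq> S) \<and>
       pairwise (\<lambda>i j. {u i<..<v i} \<inter> {u j<..<v j} = {}) {..<m} \<and>
       (\<Sum>i<m. v i - u i) < \<delta> \<longrightarrow> (\<Sum>i<m. \<bar>f (v i) - f (u i)\<bar>) < \<epsilon> / (2 * C)"
  obtain \<delta>1 where "\<delta>1 > 0" and \<delta>1: "?small \<delta>1 f"
    using f pos unfolding absolutely_continuous_fun_on_def by blast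
  obtain \<delta>2 where "\<delta>2 > 0" and \<delta>2: "?small \<delta>2 g"
    using g pos unfolding absolutely_continuous_fun_on_def by blast
  show "\<exists>\<delta>>0. \<forall>(m::nat) u v.
       (\<forall>i<m. u i \<le> v i \<and> {u i..v i} \<subseteq> S) \<and>
       pairwise (\<lambda>i j. {u i<..<v i} \<inter> {u j<..<v j} = {}) {..<m} \<and>
       (\<Sum>i<m. v i - u i) < \<delta> \<longrightarrow> (\<Sum>i<m. \<bar>h (v i) - h (u i)\<bar>) < \<epsilon>"
  proof (intro exI[of _ "min \<delta>1 \<delta>2"] conjI allI impI)
    fix m :: nat and u v
    assume *: "(\<forall>i<m. u i \<le> v i \<and> {u i..v i} \<subseteq> S) \<and>
       pairwise (\<lambda>i j. {u i<..<v i} \<inter> {u j<..<v j} = {}) {..<m} \<and>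
       (\<Sum>i<m. v i - u i) < min \<delta>1 \<delta>2"
    have sf: "(\<Sum>i<m. \<bar>f (v i) - f (u i)\<bar>) < \<epsilon> / (2 * C)" using \<delta>1 * by simp
    have sg: "(\<Sum>i<m. \<bar>g (v i) - g (u i)\<bar>) < \<epsilon> / (2 * C)" using \<delta>2 * by simp
    have mem: "u i \<in> S \<and> v i \<in> S" if "i < m" for i
      using * that by (metis atLeastAtMost_iff order_refl subsetD)
    have "(\<Sum>i<m. \<bar>h (v i) - h (u i)\<bar>)
        \<le> (\<Sum>i<m. C * \<bar>f (v i) - f (u i)\<bar> + C * \<bar>g (v i) - g (u i)\<bar>)"
      by (intro sum_mono h) (auto simp: mem)
    also have "\<dots> = C * (\<Sum>i<m. \<bar>f (v i) - f (u i)\<bar>) + C * (\<Sum>i<m. \<bar>g (v i) - g (u i)\<bar>)"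
      by (simp add: sum.distrib sum_distrib_left)
    also have "\<dots> < C * (\<epsilon> / (2 * C)) + C * (\<epsilon> / (2 * C))"
      by (intro add_strict_mono mult_strict_left_mono sf sg \<open>C > 0\<close>)
    also have "\<dots> = \<epsilon>" using \<open>C > 0\<close> by simp
    finally show "(\<Sum>i<m. \<bar>h (v i) - h (u i)\<bar>) < \<epsilon>" .
  qed (simp add: \<open>\<delta>1 > 0\<close> \<open>\<delta>2 > 0\<close>)
qed

lemma absolutely_continuous_fun_on_ident: "absolutely_continuous_fun_on (\<lambda>x. x) S"
  unfolding absolutely_continuous_fun_on_def
proof (intro allI impI)
  fix \<epsilon> :: real assume "\<epsilon> > 0"
  then show "\<exists>\<delta>>0. \<forall>(m::nat) u v. (\<forall>i<m. u i \<le> v i \<and> {u i..v i} \<subseteq> S) \<and>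
       pairwise (\<lambda>i j. {u i<..<v i} \<inter> {u j<..<v j} = {}) {..<m} \<and>
       (\<Sum>i<m. v i - u i) < \<delta> \<longrightarrow> (\<Sum>i<m. \<bar>v i - u i\<bar>) < \<epsilon>"
    by (intro exI[of _ \<epsilon>]) auto
qed

lemma absolutely_continuous_fun_on_const: "absolutely_continuous_fun_on (\<lambda>x. c) S"
  unfolding absolutely_continuous_fun_on_def by (auto intro: exI[of _ 1])

lemma absolutely_continuous_fun_on_add:
  assumes "absolutely_continuous_fun_on f S" "absolutely_continuous_fun_on g S"
  shows "absolutely_continuous_fun_on (\<lambda>x. f x + g x) S"
  by (rule absolutely_continuous_fun_on_dominated[OF assms, of _ 1]) auto

lemma absolutely_continuous_fun_on_sum:
  assumes "\<And>i. i \<in> I \<Longrightarrow> absolutely_continuous_fun_on (f i) S"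
  shows "absolutely_continuous_fun_on (\<lambda>x. \<Sum>i\<in>I. f i x) S"
  using assms
  by (induction I rule: infinite_finite_induct)
    (auto intro: absolutely_continuous_fun_on_const absolutely_continuous_fun_on_add)

lemma absolutely_continuous_fun_on_mult:
  assumes f: "absolutely_continuous_fun_on f {\<alpha>..\<beta>}" and g: "absolutely_continuous_fun_on g {\<alpha>..\<beta>}"
  shows "absolutely_continuous_fun_on (\<lambda>x. f x * g x) {\<alpha>..\<beta>}"
proof -
  have bdd: "\<exists>C>0. \<forall>x\<in>{\<alpha>..\<beta>}. \<bar>h x\<bar> \<le> C" if "absolutely_continuous_fun_on h {\<alpha>..\<beta>}" for h
    using compact_imp_bounded[OF compact_continuous_image[OF
        absolutely_continuous_fun_on_imp_continuous_on[OF that] compact_Icc]]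
    by (auto simp: bounded_pos)
  obtain A where A: "A > 0" "\<And>x. x \<in> {\<alpha>..\<beta>} \<Longrightarrow> \<bar>f x\<bar> \<le> A" using bdd[OF f] by blast
  obtain B where B: "B > 0" "\<And>x. x \<in> {\<alpha>..\<beta>} \<Longrightarrow> \<bar>g x\<bar> \<le> B" using bdd[OF g] by blast
  show ?thesis
  proof (rule absolutely_continuous_fun_on_dominated[OF f g, of _ "max A B"])
    fix u v assume uv: "u \<in> {\<alpha>..\<beta>}" "v \<in> {\<alpha>..\<beta>}"
    have "\<bar>f v * g v - f u * g u\<bar> = \<bar>g v * (f v - f u) + f u * (g v - g u)\<bar>"
      by (simp add: algebra_simps)
    also have "\<dots> \<le> \<bar>g v\<bar> * \<bar>f v - f u\<bar> + \<bar>f u\<bar> * \<bar>g v - g u\<bar>"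
      by (metis abs_triangle_ineq abs_mult)
    also have "\<dots> \<le> max A B * \<bar>f v - f u\<bar> + max A B * \<bar>g v - g u\<bar>"
      using A(2)[OF uv(1)] B(2)[OF uv(2)] by (intro add_mono mult_right_mono) auto
    finally show "\<bar>f v * g v - f u * g u\<bar> \<le> max A B * \<bar>f v - f u\<bar> + max A B * \<bar>g v - g u\<bar>" .
  qed (use A in auto)
qed

lemma absolutely_continuous_fun_on_power:
  "absolutely_continuous_fun_on f {\<alpha>..\<beta>} \<Longrightarrow> absolutely_continuous_fun_on (\<lambda>x. f x ^ m) {\<alpha>..\<beta>}"
  by (induction m)
    (auto intro: absolutely_continuous_fun_on_const absolutely_continuous_fun_on_mult)

section \<open>The fundamental theorem of calculus for absolutely continuous functions\<close>

lemma negligible_outer_open_less: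
  fixes N :: "real set"
  assumes N: "negligible N" and "\<delta> > 0"
  obtains T where "open T" "N \<subseteq> T" "T \<in> lmeasurable" "measure lebesgue T < \<delta>"
proof -
  have Nl: "N \<in> sets lebesgue" using N by (simp add: negligible_iff_null_sets null_setsD2)
  obtain T where T: "open T" "N \<subseteq> T" "T - N \<in> lmeasurable" "emeasure lebesgue (T - N) < ennreal \<delta>"
    using sets_lebesgue_outer_open[OF Nl \<open>\<delta> > 0\<close>] by metis
  have Tl: "T \<in> sets lebesgue" using T(1) by (intro sets_completionI_sets) simp
  have "emeasure lebesgue T = emeasure lebesgue (T - N)"
    using N Tl by (simp add: emeasure_Diff_null_set negligible_iff_null_sets)
  with T have em: "emeasure lebesgue T < ennreal \<delta>" by simp
  then have "emeasure lebesgue T < \<infinity>" using ennreal_less_top order.strict_trans by fastforce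
  with Tl have "T \<in> lmeasurable" by (rule fmeasurableI)
  moreover have "measure lebesgue T < \<delta>"
    using em \<open>\<delta> > 0\<close> \<open>T \<in> lmeasurable\<close> by (simp add: emeasure_eq_measure2 ennreal_less_iff)
  ultimately show thesis using that T by blast
qed

text \<open>
  Differentiability may fail on a null set, where the size of the difference quotient is not
  controlled by any gauge. There the gauge is chosen inside an open set of measure less than
  \<open>\<delta>\<close>, so that absolute continuity bounds the total increment of \<open>F\<close> over all intervals with
  an exceptional tag; on the other intervals the usual straddle estimate applies.
\<close>

theorem fundamental_theorem_of_calculus_absolutely_continuous:
  fixes F :: "real \<Rightarrow> real"
  assumes "\<alpha> \<le> \<beta>" and F: "absolutely_continuous_fun_on F {\<alpha>..\<beta>}" and N: "negligible N"
    and deriv: "\<And>x. x \<in> {\<alpha>..\<beta>} - N \<Longrightarrow> (F has_vector_derivative f x) (at x within {\<alpha>..\<beta>})"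
  shows "(f has_integral (F \<beta> - F \<alpha>)) {\<alpha>..\<beta>}"
proof -
  define g where "g x = (if x \<in> N then 0 else f x)" for x
  have "(g has_integral (F \<beta> - F \<alpha>)) {\<alpha>..\<beta>}"
    unfolding has_integral_real
  proof (intro allI impI)
    fix \<epsilon> :: real assume "\<epsilon> > 0"
    \<comment> \<open>The summand 1 keeps \<open>e\<close> finite in the degenerate case \<open>\<alpha> = \<beta>\<close>.\<close>
    define e where "e = \<epsilon> / (2 * (\<beta> - \<alpha> + 1))"
    have "e > 0" using \<open>\<epsilon> > 0\<close> \<open>\<alpha> \<le> \<beta>\<close> by (simp add: e_def)
    have e_small: "e * (\<beta> - \<alpha>) \<le> \<epsilon> / 2"
      using \<open>\<epsilon> > 0\<close> \<open>\<alpha> \<le> \<beta>\<close> by (simp add: e_def field_simps)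
    obtain \<delta> where "\<delta> > 0" and \<delta>: "\<And>(I :: (real \<times> real set) set) u v. finite I
        \<Longrightarrow> (\<And>i. i \<in> I \<Longrightarrow> u i \<le> v i \<and> {u i..v i} \<subseteq> {\<alpha>..\<beta>})
        \<Longrightarrow> pairwise (\<lambda>i j. {u i<..<v i} \<inter> {u j<..<v j} = {}) I
        \<Longrightarrow> (\<Sum>i\<in>I. v i - u i) < \<delta> \<Longrightarrow> (\<Sum>i\<in>I. \<bar>F (v i) - F (u i)\<bar>) < \<epsilon> / 2"
      using absolutely_continuous_fun_on_finite_family[OF F half_gt_zero[OF \<open>\<epsilon> > 0\<close>]] by blast
    obtain T where T: "open T" "N \<subseteq> T" "T \<in> lmeasurable" "measure lebesgue T < \<delta>"
      using negligible_outer_open_less[OF N \<open>\<delta> > 0\<close>] .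
    have "\<exists>d>0. ball x d \<subseteq> T" if "x \<in> N" for x
      using T that by (metis openE subsetD)
    moreover have "\<exists>d>0. \<forall>z\<in>{\<alpha>..\<beta>}. norm (z - x) < d \<longrightarrow>
        norm (F z - F x - (z - x) *\<^sub>R f x) \<le> e * norm (z - x)" if "x \<in> {\<alpha>..\<beta>} - N" for x
      using deriv[OF that] \<open>e > 0\<close>
      unfolding has_vector_derivative_def has_derivative_within_alt by blast
    ultimately have "\<exists>d>0. (x \<in> N \<longrightarrow> ball x d \<subseteq> T) \<and> (x \<in> {\<alpha>..\<beta>} - N \<longrightarrow>
        (\<forall>z\<in>{\<alpha>..\<beta>}. norm (z - x) < d \<longrightarrow>
          norm (F z - F x - (z - x) *\<^sub>R f x) \<le> e * norm (z - x)))" for x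
      by (cases "x \<in> N"; cases "x \<in> {\<alpha>..\<beta>}") (auto intro: zero_less_one)
    then obtain d where d: "\<And>x. d x > 0" "\<And>x. x \<in> N \<Longrightarrow> ball x (d x) \<subseteq> T"
      "\<And>x z. x \<in> {\<alpha>..\<beta>} - N \<Longrightarrow> z \<in> {\<alpha>..\<beta>} \<Longrightarrow> norm (z - x) < d x \<Longrightarrow>
          norm (F z - F x - (z - x) *\<^sub>R f x) \<le> e * norm (z - x)"
      by metis
    show "\<exists>\<gamma>. gauge \<gamma> \<and> (\<forall>p. p tagged_division_of {\<alpha>..\<beta>} \<and> \<gamma> fine p \<longrightarrow>
        norm ((\<Sum>(x, K)\<in>p. measure lborel K *\<^sub>R g x) - (F \<beta> - F \<alpha>)) < \<epsilon>)"
    proof (intro exI[of _ "\<lambda>x. ball x (d x)"] conjI allI impI)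
      show "gauge (\<lambda>x. ball x (d x))" using d(1) gauge_ball_dependent by blast
    next
      fix p assume p: "p tagged_division_of {\<alpha>..\<beta>} \<and> (\<lambda>x. ball x (d x)) fine p"
      then have ptag: "p tagged_division_of {\<alpha>..\<beta>}" and fine: "(\<lambda>x. ball x (d x)) fine p"
        by auto
      have "finite p" using ptag by blast
      define u v where "u = (\<lambda>(x :: real, K :: real set). Inf K)"
        and "v = (\<lambda>(x :: real, K :: real set). Sup K)"
      have K: "snd i = {u i..v i} \<and> u i \<le> fst i \<and> fst i \<le> v i \<and> {u i..v i} \<subseteq> {\<alpha>..\<beta>}
          \<and> {u i..v i} \<subseteq> ball (fst i) (d (fst i))" if "i \<in> p" for i
      proof -
        obtain x K where i: "i = (x, K)" by (cases i)
        have xK_in: "(x, K) \<in> p" using that i by simp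
        have xK: "x \<in> K" "K \<subseteq> {\<alpha>..\<beta>}" "K \<subseteq> ball x (d x)"
          using tagged_division_ofD(2,3)[OF ptag xK_in] fineD[OF fine xK_in] by blast+
        obtain s t where st: "K = {s..t}"
          using tagged_division_ofD(4)[OF ptag xK_in] by (auto simp: box_real)
        then have "s \<le> x" "x \<le> t" using xK(1) by auto
        then have "u i = s" "v i = t" by (simp_all add: i u_def v_def st)
        then show ?thesis using xK \<open>s \<le> x\<close> \<open>x \<le> t\<close> by (simp add: i st)
      qed
      have le: "u i \<le> v i" if "i \<in> p" for i using K[OF that] by simp
      have disj: "{u i<..<v i} \<inter> {u j<..<v j} = {}" if "i \<in> p" "j \<in> p" "i \<noteq> j" for i j
      proof -
        have "interior (snd i) \<inter> interior (snd j) = {}"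
          using tagged_division_ofD(5)[OF ptag, of "fst i" "snd i" "fst j" "snd j"] that by simp
        then show ?thesis using K[OF that(1)] K[OF that(2)] by simp
      qed
      define err where "err i = measure lborel (snd i) *\<^sub>R g (fst i) - (F (v i) - F (u i))" for i
      have content: "measure lborel (snd i) = v i - u i" if "i \<in> p" for i
        using K[OF that] content_real[of "u i" "v i"] by simp
      have total: "(\<Sum>(x, K)\<in>p. measure lborel K *\<^sub>R g x) - (F \<beta> - F \<alpha>) = (\<Sum>i\<in>p. err i)"
        using additive_tagged_division_1[OF \<open>\<alpha> \<le> \<beta>\<close> ptag, of F]
        by (simp add: err_def sum_subtractf u_def v_def split_def)
      have length: "(\<Sum>i\<in>p. v i - u i) = \<beta> - \<alpha>"
        using additive_tagged_division_1[OF \<open>\<alpha> \<le> \<beta>\<close> ptag, of "\<lambda>x. x"]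
        by (simp add: u_def v_def split_def)
      define q where "q = {i \<in> p. fst i \<in> N}"
      have q: "finite q" "q \<subseteq> p" using \<open>finite p\<close> by (auto simp: q_def)
      \<comment> \<open>Tags at which the derivative is controlled contribute at most \<open>e\<close> times the length.\<close>
      have "norm (\<Sum>i\<in>p - q. err i) \<le> (\<Sum>i\<in>p - q. e * (v i - u i))"
      proof (rule sum_norm_le)
        fix i assume i: "i \<in> p - q"
        define x where "x = fst i"
        have ip: "i \<in> p" using i by simp
        have x: "x \<in> {\<alpha>..\<beta>} - N" "u i \<le> x" "x \<le> v i"
          using K[OF ip] i by (auto simp: x_def q_def)
        have "u i \<in> {u i..v i}" "v i \<in> {u i..v i}" using x by auto
        then have mem: "u i \<in> {\<alpha>..\<beta>}" "v i \<in> {\<alpha>..\<beta>}" "u i \<in> ball x (d x)" "v i \<in> ball x (d x)"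
          using K[OF ip] unfolding x_def by blast+
        then have uv: "u i \<in> {\<alpha>..\<beta>}" "v i \<in> {\<alpha>..\<beta>}" "norm (u i - x) < d x" "norm (v i - x) < d x"
          by (simp_all only: mem_ball dist_norm norm_minus_commute)
        have "err i = (F (u i) - F x - (u i - x) *\<^sub>R f x) - (F (v i) - F x - (v i - x) *\<^sub>R f x)"
          unfolding err_def content[OF ip] x_def[symmetric] using x by (simp add: g_def algebra_simps)
        also have "norm \<dots> \<le> e * norm (u i - x) + e * norm (v i - x)"
          by (rule order_trans[OF norm_triangle_ineq4 add_mono[OF d(3) d(3)]]) (use x uv in auto)
        also have "\<dots> = e * (v i - u i)" using x by (simp add: algebra_simps)
        finally show "norm (err i) \<le> e * (v i - u i)" .
      qed
      also have "\<dots> \<le> (\<Sum>i\<in>p. e * (v i - u i))"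
        using \<open>finite p\<close> \<open>e > 0\<close> le by (intro sum_mono2) auto
      also have "\<dots> = e * (\<beta> - \<alpha>)" by (simp add: sum_distrib_left[symmetric] length)
      finally have good: "norm (\<Sum>i\<in>p - q. err i) \<le> \<epsilon> / 2" using e_small by simp
      \<comment> \<open>Intervals tagged in \<open>N\<close> are disjoint inside \<open>T\<close>, hence of small total length.\<close>
      have "(\<Sum>i\<in>q. v i - u i) = (\<Sum>i\<in>q. measure lebesgue {u i<..<v i})"
        using le q by (intro sum.cong) (auto simp: subset_iff)
      also have "\<dots> = measure lebesgue (\<Union>i\<in>q. {u i<..<v i})"
      proof (rule measure_finite_Union[symmetric])
        show "disjoint_family_on (\<lambda>i. {u i<..<v i}) q"
          using q disj unfolding disjoint_family_on_def by blast
        show "emeasure lebesgue {u i<..<v i} \<noteq> \<infinity>" if "i \<in> q" for i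
          using le[of i] q(2) that by (simp add: subsetD)
      qed (use q in auto)
      also have "\<dots> \<le> measure lebesgue T"
      proof (rule measure_mono_fmeasurable)
        show "(\<Union>i\<in>q. {u i<..<v i}) \<subseteq> T"
        proof
          fix z assume "z \<in> (\<Union>i\<in>q. {u i<..<v i})"
          then obtain i where "i \<in> q" "z \<in> {u i..v i}" by fastforce
          then have "i \<in> p" "fst i \<in> N" by (auto simp: q_def)
          then show "z \<in> T" using K[of i] d(2)[of "fst i"] \<open>z \<in> {u i..v i}\<close> by blast
        qed
        have "open (\<Union>i\<in>q. {u i<..<v i})" by (intro open_UN) auto
        then show "(\<Union>i\<in>q. {u i<..<v i}) \<in> sets lebesgue"
          by (intro sets_completionI_sets) simp
      qed (use T in auto)
      finally have "(\<Sum>i\<in>q. v i - u i) < \<delta>" using T(4) by simp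
      then have "(\<Sum>i\<in>q. \<bar>F (v i) - F (u i)\<bar>) < \<epsilon> / 2"
      proof (intro \<delta>)
        show "u i \<le> v i \<and> {u i..v i} \<subseteq> {\<alpha>..\<beta>}" if "i \<in> q" for i
          using K[of i] le[of i] q(2) that by blast
        show "pairwise (\<lambda>i j. {u i<..<v i} \<inter> {u j<..<v j} = {}) q"
          using q(2) disj unfolding pairwise_def by blast
      qed (use q in auto)
      moreover have "norm (\<Sum>i\<in>q. err i) \<le> (\<Sum>i\<in>q. \<bar>F (v i) - F (u i)\<bar>)"
        by (rule sum_norm_le) (auto simp: err_def q_def g_def)
      ultimately have bad: "norm (\<Sum>i\<in>q. err i) < \<epsilon> / 2" by simp
      have "(\<Sum>i\<in>p. err i) = (\<Sum>i\<in>p - q. err i) + (\<Sum>i\<in>q. err i)"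
        using \<open>finite p\<close> q(2) by (rule sum.subset_diff[rotated])
      then show "norm ((\<Sum>(x, K)\<in>p. measure lborel K *\<^sub>R g x) - (F \<beta> - F \<alpha>)) < \<epsilon>"
        unfolding total using good bad norm_triangle_ineq[of "\<Sum>i\<in>p - q. err i" "\<Sum>i\<in>q. err i"]
        by simp
    qed
  qed
  then show ?thesis
    by (rule has_integral_spike[OF N, rotated]) (simp add: g_def)
qed

section \<open>Taylor's formula with integral remainder\<close>

text \<open>
  The kernel satisfies \<open>d/dx (a - x)\<^sup>i / i! = - (a - x)\<^sup>i\<^sup>-\<^sup>1 / (i - 1)!\<close>, so the derivative of the
  Taylor sum telescopes and a single application of the fundamental theorem replaces \<open>m\<close>
  integrations by parts.
\<close>

lemma taylor_integral_formula:
  fixes D :: "nat \<Rightarrow> real \<Rightarrow> real"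
  assumes "\<alpha> \<le> \<beta>" and N: "negligible N"
    and AC: "\<And>i. i \<le> m \<Longrightarrow> absolutely_continuous_fun_on (D i) {\<alpha>..\<beta>}"
    and deriv: "\<And>i x. i \<le> m \<Longrightarrow> x \<in> {\<alpha>..\<beta>} - N \<Longrightarrow>
      (D i has_vector_derivative D (Suc i) x) (at x within {\<alpha>..\<beta>})"
  shows "((\<lambda>x. D (Suc m) x * ((a - x) ^ m / fact m)) has_integral
    (\<Sum>i\<le>m. D i \<beta> * ((a - \<beta>) ^ i / fact i)) - (\<Sum>i\<le>m. D i \<alpha> * ((a - \<alpha>) ^ i / fact i))) {\<alpha>..\<beta>}"
proof (rule fundamental_theorem_of_calculus_absolutely_continuous[OF \<open>\<alpha> \<le> \<beta>\<close> _ N])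
  have lin: "absolutely_continuous_fun_on (\<lambda>x. a - x) {\<alpha>..\<beta>}"
    by (rule absolutely_continuous_fun_on_dominated[OF absolutely_continuous_fun_on_ident
          absolutely_continuous_fun_on_ident, of _ _ 1]) (auto simp: abs_if)
  have "absolutely_continuous_fun_on (\<lambda>x. (a - x) ^ i / fact i) {\<alpha>..\<beta>}" for i
    using absolutely_continuous_fun_on_mult[OF absolutely_continuous_fun_on_power[OF lin]
        absolutely_continuous_fun_on_const[of "1 / fact i"], of i] by simp
  then show "absolutely_continuous_fun_on (\<lambda>x. \<Sum>i\<le>m. D i x * ((a - x) ^ i / fact i)) {\<alpha>..\<beta>}"
    by (intro absolutely_continuous_fun_on_sum absolutely_continuous_fun_on_mult AC) auto
next
  fix x assume x: "x \<in> {\<alpha>..\<beta>} - N"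
  define H where "H i x = (a - x) ^ i / fact i" for i :: nat and x :: real
  define H' where "H' i = (if i = 0 then 0 else - H (i - 1) x)" for i
  have H: "(H i has_vector_derivative H' i) (at x within {\<alpha>..\<beta>})" for i
  proof (cases i)
    case 0
    then show ?thesis by (simp add: H_def[abs_def] H'_def)
  next
    case (Suc j)
    have "((\<lambda>x. a - x) has_field_derivative -1) (at x within {\<alpha>..\<beta>})"
      by (auto intro!: derivative_eq_intros)
    from DERIV_cdivide[OF DERIV_power_Suc[OF this]]
    have "((\<lambda>x. (a - x) ^ Suc j / fact (Suc j)) has_field_derivative
        ((1 + of_nat j) * (- 1 * (a - x) ^ j)) / fact (Suc j)) (at x within {\<alpha>..\<beta>})" .
    also have "((1 + of_nat j) * (- 1 * (a - x) ^ j)) / fact (Suc j) = H' i"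
      by (simp add: H'_def H_def Suc divide_simps)
    finally show ?thesis
      by (simp add: has_real_derivative_iff_has_vector_derivative H_def[abs_def] Suc)
  qed
  have "((\<lambda>x. \<Sum>i\<le>m. D i x * H i x) has_vector_derivative
      (\<Sum>i\<le>m. D i x * H' i + D (Suc i) x * H i x)) (at x within {\<alpha>..\<beta>})"
    using x by (intro has_vector_derivative_sum has_vector_derivative_mult deriv H) auto
  also have "(\<Sum>i\<le>r. D i x * H' i + D (Suc i) x * H i x) = D (Suc r) x * H r x" for r
    by (induction r) (simp_all add: H'_def algebra_simps)
  finally show "((\<lambda>x. \<Sum>i\<le>m. D i x * ((a - x) ^ i / fact i)) has_vector_derivative
      D (Suc m) x * ((a - x) ^ m / fact m)) (at x within {\<alpha>..\<beta>})"
    by (simp add: H_def)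
qed

lemma sum_taylor_at_centre:
  fixes c :: "nat \<Rightarrow> real"
  shows "(\<Sum>i\<le>m. c i * ((a - a) ^ i / fact i)) = c 0"
  by (induction m) auto

section \<open>Functions of the Sobolev space\<close>

text \<open>For finite \<open>p\<close> the reason is \<open>\<bar>t\<bar> \<le> 1 + \<bar>t\<bar>\<^sup>p\<close>, where 1 is integrable because the measure
  is finite.\<close>

lemma Lp_functions_integrable:
  assumes "finite_measure M" and "1 \<le> p" and f: "f \<in> Lp_functions p M"
  shows "integrable M f"
proof -
  interpret finite_measure M by fact
  have meas: "f \<in> borel_measurable M" using f by (simp add: Lp_functions_def)
  show ?thesis
  proof (cases "p = \<infinity>")
    case True
    then obtain C where "AE x in M. \<bar>f x\<bar> \<le> C" using f by (auto simp: Lp_functions_def)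
    then show ?thesis using meas by (intro integrable_const_bound[of _ C]) auto
  next
    case False
    define r where "r = enn2real p"
    have "r \<ge> 1" using \<open>1 \<le> p\<close> False
      by (metis enn2real_1 enn2real_mono infinity_ennreal_def r_def top.not_eq_extremum)
    have "integrable M (\<lambda>x. 1 + \<bar>f x\<bar> powr r)"
      using f False by (auto simp: Lp_functions_def r_def)
    then show ?thesis
    proof (rule Bochner_Integration.integrable_bound[OF _ meas])
      have "\<bar>t\<bar> \<le> 1 + \<bar>t\<bar> powr r" for t :: real
      proof (cases "\<bar>t\<bar> \<le> 1")
        case True
        then show ?thesis by (simp add: add_increasing2)
      next
        case False
        then have "\<bar>t\<bar> powr 1 \<le> \<bar>t\<bar> powr r" using \<open>r \<ge> 1\<close> by (intro powr_mono) auto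
        then show ?thesis using False by simp
      qed
      then show "AE x in M. norm (f x) \<le> norm (1 + \<bar>f x\<bar> powr r)"
        by (auto simp: abs_of_nonneg)
    qed
  qed
qed

text \<open>Only the derivative of order \<open>n - 1\<close> can fail to be differentiable somewhere, so one null set
  serves for all orders.\<close>

lemma sobolev_zero_derivatives:
  assumes y: "y \<in> sobolev_zero n p"
  obtains N where "negligible N"
    and "\<And>j x. j < n \<Longrightarrow> x \<in> {0..1} - N \<Longrightarrow>
      (deriv_on {0..1} j y has_vector_derivative deriv_on {0..1} (Suc j) y x) (at x within {0..1})"
proof -
  have "AE x in lebesgue_on {0..1}. deriv_on {0..1} (n - 1) y differentiable (at x within {0..1})"
    using y by (simp add: sobolev_zero_def)
  then obtain N where N: "N \<in> null_sets (lebesgue_on {0..1})"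
    "{x \<in> space (lebesgue_on {0..1}). \<not> deriv_on {0..1} (n - 1) y differentiable (at x within {0..1})}
      \<subseteq> N"
    unfolding eventually_ae_filter by blast
  show thesis
  proof
    show "negligible N"
      using N(1) by (simp add: null_sets_restrict_space negligible_iff_null_sets)
  next
    fix j x assume "j < n" and x: "x \<in> {0..1} - N"
    have "deriv_on {0..1} j y differentiable (at x within {0..1})"
    proof (cases "j < n - 1")
      case True
      then show ?thesis using y x
        by (auto simp: sobolev_zero_def times_differentiable_on_def differentiable_on_def)
    next
      case False
      with \<open>j < n\<close> have "j = n - 1" by simp
      then show ?thesis using N(2) x by auto
    qed
    then show "(deriv_on {0..1} j y has_vector_derivative deriv_on {0..1} (Suc j) y x)
        (at x within {0..1})"
      by (simp add: vector_derivative_works)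
  qed
qed

text \<open>
  In Taylor's formula for the derivatives of order \<open>l, \<dots>, n - 1\<close>, the boundary conditions
  annihilate the endpoint 0 or 1, and at the endpoint \<open>a\<close> only the term of degree 0 survives. The
  two halves thus have opposite signs.
\<close>

lemma sobolev_zero_kernel_integrals:
  assumes y: "y \<in> sobolev_zero n p" and a: "a \<in> {0..1}" and "l < n"
  defines "K \<equiv> \<lambda>x. deriv_on {0..1} n y x * ((a - x) ^ (n - 1 - l) / fact (n - 1 - l))"
  shows "(K has_integral deriv_on {0..1} l y a) {0..a}"
    and "(K has_integral - deriv_on {0..1} l y a) {a..1}"
proof -
  define Y where "Y j = deriv_on {0..1} j y" for j
  define m where "m = n - 1 - l"
  have n: "n = l + Suc m" using \<open>l < n\<close> by (simp add: m_def)
  obtain N where N: "negligible N" and deriv: "\<And>j x. j < n \<Longrightarrow> x \<in> {0..1} - N \<Longrightarrow>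
      (Y j has_vector_derivative Y (Suc j) x) (at x within {0..1})"
    using sobolev_zero_derivatives[OF y] unfolding Y_def by blast
  have AC: "absolutely_continuous_fun_on (Y j) {0..1}" and bdry: "Y j 0 = 0" "Y j 1 = 0"
    if "j < n" for j
    using y that by (auto simp: sobolev_zero_def Y_def)
  have *: "(K has_integral (\<Sum>i\<le>m. Y (l + i) \<beta> * ((a - \<beta>) ^ i / fact i)) -
      (\<Sum>i\<le>m. Y (l + i) \<alpha> * ((a - \<alpha>) ^ i / fact i))) {\<alpha>..\<beta>}"
    if "\<alpha> \<le> \<beta>" "{\<alpha>..\<beta>} \<subseteq> {0..1}" for \<alpha> \<beta>
  proof -
    have "K = (\<lambda>x. Y (l + Suc m) x * ((a - x) ^ m / fact m))"
      by (simp only: K_def n[symmetric] m_def[symmetric] Y_def)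
    moreover have "((\<lambda>x. Y (l + Suc m) x * ((a - x) ^ m / fact m)) has_integral
        (\<Sum>i\<le>m. Y (l + i) \<beta> * ((a - \<beta>) ^ i / fact i)) -
        (\<Sum>i\<le>m. Y (l + i) \<alpha> * ((a - \<alpha>) ^ i / fact i))) {\<alpha>..\<beta>}"
    proof (rule taylor_integral_formula[OF that(1) N, where D = "\<lambda>i. Y (l + i)"])
      fix i assume "i \<le> m"
      then have "l + i < n" by (simp add: n)
      then show "absolutely_continuous_fun_on (Y (l + i)) {\<alpha>..\<beta>}"
        using AC absolutely_continuous_fun_on_subset that(2) by blast
      show "(Y (l + i) has_vector_derivative Y (l + Suc i) x) (at x within {\<alpha>..\<beta>})"
        if x: "x \<in> {\<alpha>..\<beta>} - N" for x
        using deriv[OF \<open>l + i < n\<close>, of x] x \<open>{\<alpha>..\<beta>} \<subseteq> {0..1}\<close>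
        by (auto intro: has_vector_derivative_within_subset)
    qed
    ultimately show ?thesis by simp
  qed
  have at0: "(\<Sum>i\<le>m. Y (l + i) 0 * c i) = 0" and at1: "(\<Sum>i\<le>m. Y (l + i) 1 * c i) = 0"
    for c :: "nat \<Rightarrow> real"
    by (auto intro!: sum.neutral simp: bdry n)
  have ata: "(\<Sum>i\<le>m. Y (l + i) a * ((a - a) ^ i / fact i)) = Y l a"
    using sum_taylor_at_centre[where c = "\<lambda>i. Y (l + i) a"] by simp
  show "(K has_integral deriv_on {0..1} l y a) {0..a}"
    using *[of 0 a] a unfolding ata at0 by (simp add: Y_def)
  show "(K has_integral - deriv_on {0..1} l y a) {a..1}"
    using *[of a 1] a unfolding ata at1 by (simp add: Y_def)
qed

section \<open>The representation formula\<close>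

theorem mainTheorem1:
  fixes n k :: nat and p :: ennreal and a :: real
    and \<nu> :: "nat \<Rightarrow> real" and Q y :: "real \<Rightarrow> real"
  assumes "k \<in> {0..n - 1}" and "1 \<le> n" and "1 \<le> p" and "a \<in> {0<..<1}"
    and "times_differentiable_on n Q ({0..1} - {a})"
    and "\<And>x. x \<in> {0..<a} \<Longrightarrow>
      deriv_on ({0..1} - {a}) n Q x =
        (\<Sum>l\<in>{0..n - 1} - {k}. (-1) ^ (n - l - 1) * (x - a) ^ (n - 1 - l) * \<nu> l / fact (n - 1 - l))
        + (-1) ^ (n - 1 - k) * (x - a) ^ (n - 1 - k) * (\<nu> k + 1) / fact (n - 1 - k)"
    and "\<And>x. x \<in> {a<..1} \<Longrightarrow>
      deriv_on ({0..1} - {a}) n Q x =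
        (\<Sum>l = 0..n - 1. (-1) ^ (n - l - 1) * (x - a) ^ (n - 1 - l) * \<nu> l / fact (n - 1 - l))"
    and "y \<in> sobolev_zero n p"
  shows "integrable (lebesgue_on {0..1})
           (\<lambda>x. deriv_on {0..1} n y x * deriv_on ({0..1} - {a}) n Q x) \<and>
         deriv_on {0..1} k y a =
           (LINT x|lebesgue_on {0..1}. deriv_on {0..1} n y x * deriv_on ({0..1} - {a}) n Q x)"
proof -
  define Y where "Y j = deriv_on {0..1} j y" for j
  define q where "q = deriv_on ({0..1} - {a}) n Q"
  define P where "P c x = (\<Sum>l<n. c l * ((a - x) ^ (n - 1 - l) / fact (n - 1 - l)))"
    for c :: "nat \<Rightarrow> real" and x :: real
  define \<mu> where "\<mu> l = \<nu> l + (if l = k then 1 else 0)" for l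
  have "k < n" and a: "0 < a" "a < 1" using assms(1,2,4) by auto
  have sign: "(-1) ^ (n - l - 1) * (x - a) ^ (n - 1 - l) * c / fact (n - 1 - l)
      = c * ((a - x) ^ (n - 1 - l) / fact (n - 1 - l))" for x c :: real and l
    by (simp add: power_mult_distrib[symmetric])
  have sign_k: "(-1) ^ (n - 1 - k) * (x - a) ^ (n - 1 - k) * c / fact (n - 1 - k)
      = c * ((a - x) ^ (n - 1 - k) / fact (n - 1 - k))" for x c :: real
    by (simp add: power_mult_distrib[symmetric])
  have idx: "{0..n - 1} = {..<n}" using \<open>1 \<le> n\<close> by auto
  have q_left: "q x = P \<mu> x" if "x \<in> {0..<a}" for x
  proof -
    have "q x = (\<Sum>l\<in>{..<n} - {k}. \<nu> l * ((a - x) ^ (n - 1 - l) / fact (n - 1 - l)))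
        + (\<nu> k + 1) * ((a - x) ^ (n - 1 - k) / fact (n - 1 - k))"
      using assms(6)[OF that] sign_k unfolding sign idx q_def by simp
    also have "\<dots> = P \<mu> x"
      using \<open>k < n\<close> unfolding P_def
      by (subst sum.remove[of "{..<n}" k]) (auto simp: \<mu>_def intro!: sum.cong)
    finally show ?thesis .
  qed
  have q_right: "q x = P \<nu> x" if "x \<in> {a<..1}" for x
    using assms(7)[OF that] unfolding sign idx q_def P_def .

  \<comment> \<open>Each summand of the kernel reproduces one derivative of \<open>y\<close> at \<open>a\<close>.\<close>
  have "((\<lambda>x. \<Sum>l<n. c l * (Y n x * ((a - x) ^ (n - 1 - l) / fact (n - 1 - l)))) has_integral
      (\<Sum>l<n. c l * Y l a)) {0..a}" for c
    using a unfolding Y_def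
    by (intro has_integral_sum has_integral_mult_right
        sobolev_zero_kernel_integrals(1)[OF assms(8)]) auto
  then have P_left: "((\<lambda>x. Y n x * P c x) has_integral (\<Sum>l<n. c l * Y l a)) {0..a}" for c
    by (simp add: P_def sum_distrib_left mult.left_commute)
  have "((\<lambda>x. \<Sum>l<n. c l * (Y n x * ((a - x) ^ (n - 1 - l) / fact (n - 1 - l)))) has_integral
      (\<Sum>l<n. c l * - Y l a)) {a..1}" for c
    using a unfolding Y_def
    by (intro has_integral_sum has_integral_mult_right
        sobolev_zero_kernel_integrals(2)[OF assms(8)]) auto
  then have P_right: "((\<lambda>x. Y n x * P c x) has_integral (\<Sum>l<n. c l * - Y l a)) {a..1}" for c
    by (simp add: P_def sum_distrib_left mult.left_commute)
  have "((\<lambda>x. Y n x * q x) has_integral (\<Sum>l<n. \<mu> l * Y l a)) {0..a}"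
    by (rule has_integral_spike_finite[OF _ _ P_left, of "{a}"]) (use q_left in auto)
  moreover have "((\<lambda>x. Y n x * q x) has_integral (\<Sum>l<n. \<nu> l * - Y l a)) {a..1}"
    by (rule has_integral_spike_finite[OF _ _ P_right, of "{a}"]) (use q_right in auto)
  ultimately have "((\<lambda>x. Y n x * q x) has_integral
      (\<Sum>l<n. \<mu> l * Y l a) + (\<Sum>l<n. \<nu> l * - Y l a)) {0..1}"
    using a by (intro has_integral_combine) auto
  also have "(\<Sum>l<n. \<mu> l * Y l a) + (\<Sum>l<n. \<nu> l * - Y l a) = (\<Sum>l<n. if l = k then Y l a else 0)"
    unfolding sum.distrib[symmetric]
    by (intro sum.cong refl) (simp add: \<mu>_def algebra_simps)
  also have "\<dots> = Y k a" using \<open>k < n\<close> by simp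
  finally have value_eq: "((\<lambda>x. Y n x * q x) has_integral Y k a) {0..1}" .

  \<comment> \<open>Keeping the unknown value of \<open>q\<close> at \<open>a\<close> makes \<open>w\<close> agree with \<open>q\<close> on the whole interval,
      while the piecewise form shows that it is measurable and bounded.\<close>
  define w where "w x = (if x < a then P \<mu> x else if x = a then q a else P \<nu> x)" for x
  have qw: "q x = w x" if "x \<in> {0..1}" for x
    using q_left[of x] q_right[of x] that by (auto simp: w_def)
  have P_cont: "continuous_on S (P c)" for c S
    unfolding P_def[abs_def] by (intro continuous_intros) auto
  have "w \<in> borel_measurable borel"
    unfolding w_def[abs_def]
    by (intro measurable_If borel_measurable_continuous_onI P_cont) auto
  then have w_meas: "w \<in> borel_measurable (lebesgue_on {0..1})"
    by (simp add: measurable_completion measurable_restrict_space1)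
  have P_bdd: "\<exists>C. \<forall>x\<in>{0..1}. \<bar>P c x\<bar> \<le> C" for c
    using compact_imp_bounded[OF compact_continuous_image[OF P_cont[of "{0..1}" c] compact_Icc]]
    by (auto simp: bounded_iff)
  obtain A B where AB: "\<And>x. x \<in> {0..1} \<Longrightarrow> \<bar>P \<mu> x\<bar> \<le> A" "\<And>x. x \<in> {0..1} \<Longrightarrow> \<bar>P \<nu> x\<bar> \<le> B"
    using P_bdd by metis
  define C where "C = max (max A B) \<bar>q a\<bar>"
  have w_bdd: "\<bar>w x\<bar> \<le> C" if "x \<in> {0..1}" for x
    using AB[OF that] by (auto simp: w_def C_def)
  have "Y n \<in> Lp_functions p (lebesgue_on {0..1})"
    using assms(8) by (simp add: sobolev_zero_def Y_def)
  then have Yn: "integrable (lebesgue_on {0..1}) (Y n)"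
    by (rule Lp_functions_integrable[OF _ \<open>1 \<le> p\<close>, rotated])
      (simp add: finite_measure_lebesgue_on)
  have "integrable (lebesgue_on {0..1}) (\<lambda>x. Y n x * w x)"
  proof (rule Bochner_Integration.integrable_bound)
    show "integrable (lebesgue_on {0..1}) (\<lambda>x. C * Y n x)" using Yn by simp
    show "(\<lambda>x. Y n x * w x) \<in> borel_measurable (lebesgue_on {0..1})"
      using Yn w_meas by auto
    have "\<bar>Y n x * w x\<bar> \<le> \<bar>C * Y n x\<bar>" if "x \<in> {0..1}" for x
      using mult_left_mono[OF order_trans[OF w_bdd[OF that] abs_ge_self], of "\<bar>Y n x\<bar>"]
      by (simp add: abs_mult mult.commute)
    then show "AE x in lebesgue_on {0..1}. norm (Y n x * w x) \<le> norm (C * Y n x)"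
      by (intro AE_I2) auto
  qed
  then have int: "integrable (lebesgue_on {0..1}) (\<lambda>x. Y n x * q x)"
    by (rule Bochner_Integration.integrable_cong[THEN iffD1, rotated 2]) (auto simp: qw)
  have "(LINT x|lebesgue_on {0..1}. Y n x * q x) = Y k a"
    using lebesgue_integral_eq_integral[OF int] integral_unique[OF value_eq] by simp
  with int show ?thesis by (simp add: Y_def q_def)
qed

end
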